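(* For all positive integers $n$ and $k$ with $n\ge2$ and $k\le\varphi(n)$, \[a_n(k)=\frac{e^{\Lambda(n)}}{k!}\sum_{t=k}^{\varphi(n)}\frac{(-1)^{t-k}}{(t-k)!}\,\mathcal{B}_t\Big(\sum_{j=1}^{1}\frac{B_j^+s(1,j)}{j}J_j(n),\,\dots,\,\sum_{j=1}^{t}\frac{B_j^+s(t,j)}{j}J_j(n)\Big).\]
   Context: $\Phi_n(x)=\sum_{j=0}^{\varphi(n)}a_n(j)x^j$ is the $n$-th cyclotomic polynomial, $\varphi$ is Euler's totient, and $\Lambda$ is the von Mangoldt function ($\Lambda(n)=\log p$ if $n$ is a power $p^m$, $m\ge1$, of a prime $p$, and $0$ otherwise). $s(t,j)$: signed Stirling numbers of the first kind ($x(x-1)\cdots(x-t+1)=\sum_j s(t,j)x^j$); $B_j^+$: $\frac{te^t}{e^t-1}=\sum_j B_j^+t^j/j!$; $J_j(n)=n^j\prod_{p\mid n}(1-p^{-j})$. $\mathcal{B}_t(x_1,\dots,x_t)=\sum\frac{t!}{\lambda_1!\cdots\lambda_t!}\prod_{j}(x_j/j!)^{\lambda_j}$ over non-negative integer tuples with $\sum_j j\lambda_j=t$, and $\mathcal{B}_0=1$. *)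

theory Defs
  imports
    Complex_Main
    "HOL-Library.FuncSet"
    "HOL-Computational_Algebra.Computational_Algebra"
    "HOL-Number_Theory.Totient"
    "HOL-Number_Theory.Prime_Powers"
begin

definition cyclotomic_poly :: "nat \<Rightarrow> complex poly" where
  "cyclotomic_poly n = (\<Prod>m\<in>totatives n. [:- cis (2 * pi * real m / real n), 1:])"

lemma degree_cyclotomic_poly: "degree (cyclotomic_poly n) = totient n"
  unfolding cyclotomic_poly_def totient_def
  by (subst degree_prod_eq_sum_degree) auto

definition signed_stirling :: "nat \<Rightarrow> nat \<Rightarrow> int" where
  "signed_stirling t j = Polynomial.coeff (\<Prod>i<t. [:- int i, 1:]) j"

(* Fps division is exact here because the divisor has subdegree 1; see the next lemma. *)
definition bernoulli_plus :: "nat \<Rightarrow> real" where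
  "bernoulli_plus j = fact j * fps_nth (fps_X * fps_exp 1 / (fps_exp 1 - 1)) j"

lemma bernoulli_plus_egf:
  "Abs_fps (\<lambda>j. bernoulli_plus j / fact j) * (fps_exp 1 - 1) = fps_X * fps_exp 1"
proof -
  have nz: "fps_exp (1::real) - 1 \<noteq> 0"
  proof
    assume "fps_exp (1::real) - 1 = 0"
    then have "fps_nth (fps_exp (1::real) - 1) 1 = 0" by simp
    then show False by simp
  qed
  have "(fps_exp (1::real) - 1) dvd fps_X * fps_exp 1"
  proof -
    have "subdegree (fps_exp (1::real) - 1) = 1"
      by (rule subdegreeI) auto
    moreover have "subdegree (fps_X * fps_exp (1::real)) = 1"
      by (rule subdegreeI) auto
    moreover have "fps_X * fps_exp (1::real) \<noteq> 0" by auto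
    ultimately show ?thesis using nz by (simp add: fps_dvd_iff)
  qed
  then show ?thesis
    by (simp add: bernoulli_plus_def fps_nth_inverse)
qed

definition jordan_totient :: "nat \<Rightarrow> nat \<Rightarrow> real" where
  "jordan_totient j n = real n ^ j * (\<Prod>p\<in>prime_factors n. 1 - 1 / real p ^ j)"

(* The argument list x_1, ..., x_t is given by a function, of which only the values at
   1, ..., t are used; the tuple of multiplicities is an extensional function on {1..t}. *)
definition complete_bell :: "nat \<Rightarrow> (nat \<Rightarrow> real) \<Rightarrow> real" where
  "complete_bell t x =
     (\<Sum>l | l \<in> {1..t} \<rightarrow>\<^sub>E (UNIV :: nat set) \<and> (\<Sum>j=1..t. j * l j) = t.
        fact t / (\<Prod>j=1..t. fact (l j)) * (\<Prod>j=1..t. (x j / fact j) ^ l j))"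

lemma finite_complete_bell_index:
  "finite {l. l \<in> {1..t} \<rightarrow>\<^sub>E (UNIV :: nat set) \<and> (\<Sum>j=1..t. j * l j) = t}"
proof (rule finite_subset)
  show "{l. l \<in> {1..t} \<rightarrow>\<^sub>E (UNIV :: nat set) \<and> (\<Sum>j=1..t. j * l j) = t}
          \<subseteq> {1..t} \<rightarrow>\<^sub>E {..t}"
  proof (clarify, rule PiE_I)
    fix l :: "nat \<Rightarrow> nat" and j
    assume sum: "(\<Sum>j=1..t. j * l j) = t" and j: "j \<in> {1..t}"
    have "l j \<le> j * l j" using j by simp
    also have "\<dots> \<le> (\<Sum>j=1..t. j * l j)" using j by (intro member_le_sum) auto
    finally show "l j \<in> {..t}" using sum by simp
  qed auto
qed (auto intro: finite_PiE)

lemma complete_bell_0: "complete_bell 0 x = 1"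
  by (simp add: complete_bell_def)

end

theory Submission
  imports Defs
begin

text \<open>
  Since \<open>z * e^z / (e^z - 1) = \<Sum>j. B_j z^j / j!\<close>, where \<open>B_j\<close> is \<open>bernoulli_plus j\<close>,
  integration gives \<open>e^z - 1 = z * exp (L z)\<close> with \<open>L z = \<Sum>j\<ge>1. B_j / j * z^j / j!\<close>.
  Substituting \<open>n * ln (1 + y)\<close> for \<open>z\<close> writes
  \<open>(1 + y)^n - 1\<close>, which is the product of \<open>\<Phi>_d (1 + y)\<close> over \<open>d dvd n\<close>, as an exponential; because
  \<open>\<Sum>d | d dvd n. J_j d = n^j\<close> and \<open>\<Sum>d | d dvd n. \<Lambda> d = ln n\<close>, the power series
  \<open>exp (\<Lambda> d) * exp (\<Sum>j\<ge>1. B_j / j * J_j d * ln (1 + y)^j / j!)\<close> satisfy the same product formula for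
  \<open>d \<ge> 2\<close>, hence equal \<open>\<Phi>_d (1 + y)\<close> by induction. Expanding
  \<open>ln (1 + y)^j / j! = \<Sum>i. s i j * y^i / i!\<close> turns the exponential into the generating function of the
  complete Bell polynomials, and re-expanding at \<open>0\<close> instead of \<open>1\<close> gives the coefficients.
\<close>

subsection \<open>Exponentials of power series and complete Bell polynomials\<close>

text \<open>The coefficient of \<open>X^m\<close> in \<open>f' = a * f\<close> expresses
  \<open>(m + 1) * f_(m+1)\<close> through the coefficients up to \<open>m\<close>, so in
  characteristic 0 the constant term determines the rest.\<close>

lemma fps_linear_ode_unique:
  fixes f g a :: "'a::field_char_0 fps"
  assumes "fps_deriv f = a * f" "fps_deriv g = a * g" "fps_nth f 0 = fps_nth g 0"
  shows "f = g"
proof (rule fps_ext)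
  fix n show "fps_nth f n = fps_nth g n"
  proof (induction n rule: less_induct)
    case (less n)
    show ?case
    proof (cases n)
      case 0
      then show ?thesis using assms by simp
    next
      case (Suc m)
      have "of_nat (Suc m) * fps_nth h (Suc m) = (\<Sum>i=0..m. fps_nth a i * fps_nth h (m - i))"
        if "fps_deriv h = a * h" for h
        using arg_cong[OF that, of "\<lambda>f. fps_nth f m"]
        by (simp only: fps_mult_nth fps_deriv_nth Suc_eq_plus1)
      note rec = this[OF assms(1)] this[OF assms(2)]
      have "(\<Sum>i=0..m. fps_nth a i * fps_nth f (m - i)) = (\<Sum>i=0..m. fps_nth a i * fps_nth g (m - i))"
        by (intro sum.cong refl arg_cong2[where f = "(*)"] less.IH) (simp add: Suc)
      then have "of_nat (Suc m) * fps_nth f (Suc m) = of_nat (Suc m) * fps_nth g (Suc m)"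
        by (simp only: rec)
      then show ?thesis unfolding Suc by (simp del: of_nat_Suc)
    qed
  qed
qed

lemma fps_deriv_exp_compose:
  fixes g :: "'a::field_char_0 fps"
  assumes "fps_nth g 0 = 0"
  shows "fps_deriv (fps_exp 1 oo g) = fps_deriv g * (fps_exp 1 oo g)"
  by (subst fps_compose_deriv[OF assms]) (simp add: mult.commute)

text \<open>Recognises a series as an exponential from its constant term and logarithmic derivative.
  Every later exponential identity proved by differentiation with \<open>g\<close> known rests on
  it.\<close>

lemma fps_exp_compose_eqI:
  fixes f g :: "'a::field_char_0 fps"
  assumes "fps_nth g 0 = 0" "fps_nth f 0 = 1" "fps_deriv f = fps_deriv g * f"
  shows "fps_exp 1 oo g = f"
  by (rule fps_linear_ode_unique[where a = "fps_deriv g"])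
     (simp_all add: fps_deriv_exp_compose assms del: fps_deriv_nth)

lemma fps_exp_compose_add:
  fixes f g :: "'a::field_char_0 fps"
  assumes "fps_nth f 0 = 0" "fps_nth g 0 = 0"
  shows "fps_exp 1 oo (f + g) = (fps_exp 1 oo f) * (fps_exp 1 oo g)"
  using assms by (subst fps_exp_compose_eqI) (simp_all add: fps_deriv_exp_compose algebra_simps)

lemma fps_exp_compose_sum:
  fixes f :: "'b \<Rightarrow> 'a::field_char_0 fps"
  assumes "finite A" "\<And>i. i \<in> A \<Longrightarrow> fps_nth (f i) 0 = 0"
  shows "fps_exp 1 oo (\<Sum>i\<in>A. f i) = (\<Prod>i\<in>A. fps_exp 1 oo f i)"
  using assms by (induction A) (simp_all add: fps_exp_compose_add fps_sum_nth)

lemma fps_exp_compose_X_power: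
  fixes c :: "'a::field_char_0"
  assumes "m \<ge> 1"
  shows "fps_exp 1 oo (fps_const c * fps_X ^ m) = fps_exp c oo fps_X ^ m"
proof (rule fps_exp_compose_eqI)
  have 0: "fps_nth (fps_X ^ m :: 'a fps) 0 = 0" using assms by simp
  then show "fps_nth (fps_const c * fps_X ^ m) 0 = 0" "fps_nth (fps_exp c oo fps_X ^ m) 0 = 1"
    by simp_all
  show "fps_deriv (fps_exp c oo fps_X ^ m) = fps_deriv (fps_const c * fps_X ^ m) * (fps_exp c oo fps_X ^ m)"
    unfolding fps_compose_deriv[OF 0] fps_exp_deriv fps_compose_mult_distrib[OF 0] fps_const_compose
      fps_deriv_mult_const_left by (simp only: mult_ac)
qed

text \<open>The derivative of \<open>exp f\<close> is \<open>f' * exp f\<close>, and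
  \<open>f'\<close> vanishes below degree \<open>t\<close>. This serves to discard the tail of an
  exponent.\<close>

lemma fps_exp_compose_nth_low:
  fixes f :: "'a::field_char_0 fps"
  assumes "\<And>i. i \<le> t \<Longrightarrow> fps_nth f i = 0" "1 \<le> i" "i \<le> t"
  shows "fps_nth (fps_exp 1 oo f) i = 0"
proof -
  obtain m where m: "i = Suc m" using assms(2) by (cases i) auto
  have "of_nat (Suc m) * fps_nth (fps_exp 1 oo f) (Suc m)
    = fps_nth (fps_deriv f * (fps_exp 1 oo f)) m"
    unfolding fps_deriv_exp_compose[OF assms(1)[OF zero_le], symmetric] by simp
  also have "\<dots> = 0"
    using assms(1,3) m by (auto simp: fps_mult_nth intro!: sum.neutral)
  finally show ?thesis using m by (simp del: of_nat_Suc)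
qed

text \<open>Picking the term of index \<open>l j\<close> in each \<open>F j\<close> contributes
  degree \<open>j * l j\<close>, so the tuples of weight \<open>t\<close> index the contributions.
  The induction splits off the last factor.\<close>

lemma fps_nth_prod_compose_X_power:
  fixes F :: "nat \<Rightarrow> 'a::comm_ring_1 fps"
  shows "fps_nth (\<Prod>j=1..m. F j oo fps_X ^ j) t =
    (\<Sum>l | l \<in> {1..m} \<rightarrow>\<^sub>E (UNIV :: nat set) \<and> (\<Sum>j=1..m. j * l j) = t.
       \<Prod>j=1..m. fps_nth (F j) (l j))"
proof (induction m arbitrary: t)
  case 0
  then show ?case by (cases t) auto
next
  case (Suc m)
  define A where "A m t = {l. l \<in> {1..m} \<rightarrow>\<^sub>E (UNIV :: nat set) \<and> (\<Sum>j=1..m. j * l j) = t}" for m t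
  have fin: "finite (A m t)" for m t
  proof (rule finite_subset)
    show "A m t \<subseteq> {1..m} \<rightarrow>\<^sub>E {..t}"
    proof (intro subsetI PiE_I)
      fix l j
      assume l: "l \<in> A m t" and j: "j \<in> {1..m}"
      have "l j \<le> j * l j" using j by simp
      also have "\<dots> \<le> (\<Sum>j=1..m. j * l j)" using j by (intro member_le_sum) auto
      also have "\<dots> = t" using l by (simp add: A_def)
      finally show "l j \<in> {..t}" by simp
    qed (auto simp: A_def)
  qed (auto intro: finite_PiE)
  have X: "fps_nth (F (Suc m) oo fps_X ^ Suc m) i =
      (if Suc m dvd i then fps_nth (F (Suc m)) (i div Suc m) else 0)" for i
    by (rule fps_nth_compose_X_power)
  define G where "G l = (\<Prod>j=1..m. fps_nth (F j) (l j))" for l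
  have G: "G (l(Suc m := r)) = G l" "G (restrict l {1..m}) = G l" for l r
    unfolding G_def by (auto intro!: prod.cong)
  have upd: "(\<Sum>j=1..m. j * (l(Suc m := r)) j) = (\<Sum>j=1..m. j * l j)"
    "(\<Sum>j=1..m. j * restrict l {1..m} j) = (\<Sum>j=1..m. j * l j)" for l r
    by (auto intro!: sum.cong)
  have "fps_nth (\<Prod>j=1..Suc m. F j oo fps_X ^ j) t =
     (\<Sum>i=0..t. fps_nth (F (Suc m) oo fps_X ^ Suc m) i * fps_nth (\<Prod>j=1..m. F j oo fps_X ^ j) (t - i))"
    by (simp add: mult.commute[of "prod _ _"] fps_mult_nth)
  \<comment> \<open>A series in \<open>X ^ Suc m\<close> has nonzero coefficients only at multiples
    of \<open>Suc m\<close>.\<close>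
  also have "\<dots> = (\<Sum>i | i \<le> t \<and> Suc m dvd i. fps_nth (F (Suc m)) (i div Suc m) *
                 (\<Sum>l\<in>A m (t - i). G l))"
    by (rule sum.mono_neutral_cong_right) (use X Suc in \<open>auto simp: A_def G_def simp del: power_Suc One_nat_def\<close>)
  also have "\<dots> = (\<Sum>(i, l)\<in>(SIGMA i:{i. i \<le> t \<and> Suc m dvd i}. A m (t - i)).
        fps_nth (F (Suc m)) (i div Suc m) * G l)"
    by (subst sum.Sigma [symmetric]) (simp_all add: sum_distrib_left fin)
  also have "\<dots> = (\<Sum>l\<in>A (Suc m) t. G l * fps_nth (F (Suc m)) (l (Suc m)))"
  \<comment> \<open>The degree \<open>i\<close> taken from the last factor becomes the new entry
    \<open>i div Suc m\<close> of the tuple; restricting to \<open>{1..m}\<close> removes it and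
    keeps the tuple extensional.\<close>
  proof (rule sum.reindex_bij_witness[where i = "\<lambda>l. (Suc m * l (Suc m), restrict l {1..m})"
          and j = "\<lambda>(i, l). l(Suc m := i div Suc m)"], goal_cases)
    case (1 a)
    then obtain i l where [simp]: "a = (i, l)" and *: "Suc m dvd i" "l \<in> A m (t - i)" by auto
    have "restrict (l(Suc m := i div Suc m)) {1..m} = l"
      using *(2) by (auto simp: A_def PiE_def extensional_def restrict_def)
    then show ?case using *(1) by (simp del: mult_Suc)
  next
    case (2 a)
    then obtain i l where [simp]: "a = (i, l)"
      and *: "i \<le> t" "Suc m dvd i" "l \<in> {1..m} \<rightarrow>\<^sub>E UNIV" "(\<Sum>j=1..m. j * l j) = t - i"
      by (auto simp: A_def)
    have "l(Suc m := i div Suc m) \<in> {1..Suc m} \<rightarrow>\<^sub>E UNIV"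
      using *(3) by (auto simp: PiE_def extensional_def)
    moreover have "(\<Sum>j=1..Suc m. j * (l(Suc m := i div Suc m)) j) = t"
      using * upd(1)[of l "i div Suc m"] by (simp del: mult_Suc)
    ultimately show ?case by (simp add: A_def)
  next
    case (3 l)
    then have "l i = undefined" if "i \<notin> {1..Suc m}" for i
      using that by (auto simp: A_def PiE_def extensional_def)
    then have "(restrict l {1..m})(Suc m := l (Suc m)) = l"
      by (intro ext) (auto simp: restrict_def)
    then show ?case by (simp del: mult_Suc)
  next
    case (4 l)
    then have "(\<Sum>j=1..m. j * l j) + Suc m * l (Suc m) = t"
      by (simp add: A_def del: mult_Suc)
    then have "Suc m * l (Suc m) \<le> t" "(\<Sum>j=1..m. j * l j) = t - Suc m * l (Suc m)"
      by linarith+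
    then show ?case using upd(2)[of l]
      by (simp add: A_def del: mult_Suc)
  next
    case (5 a)
    then show ?case by (auto simp: G)
  qed
  finally show ?case by (simp add: A_def G_def del: One_nat_def)
qed

text \<open>Let \<open>S\<close> be \<open>g\<close> truncated after degree \<open>t\<close>. Then
  \<open>exp g = exp S * exp (g - S)\<close>, and the second factor is 1 up to degree
  \<open>t\<close>. The first is the finite product of the \<open>exp (g_j * X^j)\<close>, whose
  expansion is indexed by the multiplicity tuples of the Bell polynomial.\<close>

lemma complete_bell_egf:
  fixes x :: "nat \<Rightarrow> real" and g :: "'a::real_field fps"
  assumes "fps_nth g 0 = 0" "\<And>i. 1 \<le> i \<Longrightarrow> i \<le> t \<Longrightarrow> fps_nth g i = of_real (x i / fact i)"
  shows "fps_nth (fps_exp 1 oo g) t = of_real (complete_bell t x / fact t)"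
proof -
  have ge1: "j \<ge> 1" if "j \<in> {1..t}" for j using that by simp
  define S where "S = (\<Sum>j=1..t. fps_const (fps_nth g j) * fps_X ^ j)"
  have S: "fps_nth S i = (if i \<in> {1..t} then fps_nth g i else 0)" for i
    by (auto simp: S_def fps_sum_nth fps_X_power_nth if_distrib[of "\<lambda>y. _ * y"] cong: if_cong)
  have R: "fps_nth (g - S) i = 0" if "i \<le> t" for i
    using that assms(1) by (cases i) (auto simp: S)
  have "fps_exp 1 oo g = (fps_exp 1 oo S) * (fps_exp 1 oo (g - S))"
    using fps_exp_compose_add[of S "g - S"] assms(1) S by simp
  then have "fps_nth (fps_exp 1 oo g) t =
      (\<Sum>i=0..t. fps_nth (fps_exp 1 oo S) i * fps_nth (fps_exp 1 oo (g - S)) (t - i))"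
    by (simp add: fps_mult_nth)
  also have "\<dots> = (\<Sum>i\<in>{t}. fps_nth (fps_exp 1 oo S) i)"
  proof (rule sum.mono_neutral_cong_right)
    show "\<forall>i\<in>{0..t} - {t}. fps_nth (fps_exp 1 oo S) i * fps_nth (fps_exp 1 oo (g - S)) (t - i) = 0"
      using fps_exp_compose_nth_low[OF R] by auto
  qed (auto simp: R)
  also have "\<dots> = fps_nth (\<Prod>j=1..t. fps_exp (fps_nth g j) oo fps_X ^ j) t"
    unfolding S_def
    by (subst fps_exp_compose_sum)
       (auto simp: fps_exp_compose_X_power[OF ge1] intro!: arg_cong2[where f = fps_nth] prod.cong)
  also have "\<dots> = (\<Sum>l | l \<in> {1..t} \<rightarrow>\<^sub>E (UNIV :: nat set) \<and> (\<Sum>j=1..t. j * l j) = t.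
       \<Prod>j=1..t. of_real (x j / fact j) ^ l j / fact (l j))"
    by (subst fps_nth_prod_compose_X_power) (auto intro!: sum.cong prod.cong simp: assms(2))
  also have "\<dots> = of_real (complete_bell t x / fact t)"
    by (simp add: complete_bell_def sum_divide_distrib prod_dividef)
  finally show ?thesis .
qed

subsection \<open>Stirling and Bernoulli numbers\<close>

text \<open>Both sides solve \<open>(1 + X) * f' = c * f\<close> with constant term 1;
  \<open>fps_ln 1\<close> is the series of \<open>ln (1 + X)\<close>.\<close>

lemma fps_exp_compose_ln:
  fixes c :: "'a::field_char_0"
  shows "fps_exp c oo fps_ln 1 = fps_binomial c"
proof -
  have "fps_deriv (fps_exp c oo fps_ln 1) = fps_const c * (fps_exp c oo fps_ln 1) / (1 + fps_X)"
    by (simp add: fps_compose_deriv fps_compose_mult_distrib fps_ln_deriv fps_divide_unit)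
  then show ?thesis
    by (intro iffD1[OF fps_binomial_ODE_unique'] conjI) simp_all
qed

text \<open>Comparing the coefficients of \<open>(1 + y)^n = exp (n * ln (1 + y))\<close>, as polynomials in \<open>n\<close>.\<close>
lemma fps_ln_power_nth:
  assumes "j \<le> i"
  shows "fps_nth (fps_ln (1::'a::field_char_0) ^ j) i = of_int (signed_stirling i j) * fact j / fact i"
proof -
  define p :: "'a poly" where "p = (\<Sum>j\<le>i. monom (fps_nth (fps_ln 1 ^ j) i / fact j) j)"
  define q :: "'a poly" where "q = (\<Sum>j\<le>i. monom (of_int (signed_stirling i j) / fact i) j)"
  \<comment> \<open>At every natural number both polynomials take the value
    \<open>x gchoose i\<close>: once through the binomial series, once through the falling
    factorial. Agreement at infinitely many points forces \<open>p = q\<close>.\<close>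
  have "poly p x = poly q x" if x: "x \<in> range of_nat" for x
  proof -
    from x obtain n where n: "x = of_nat n" by auto
    have "poly p x = x gchoose i"
      using arg_cong[OF fps_exp_compose_ln[of x], of "\<lambda>f. fps_nth f i"]
      by (simp add: p_def poly_sum poly_monom fps_compose_nth atLeast0AtMost mult_ac)
    also have "x gchoose i = of_int (poly (\<Prod>k<i. [:- int k, 1:]) (int n)) / fact i"
      by (simp add: n gbinomial_prod_rev poly_prod atLeast0LessThan)
    also have "poly (\<Prod>k<i. [:- int k, 1:]) (int n) = (\<Sum>j\<le>i. signed_stirling i j * int n ^ j)"
      by (simp add: poly_altdef signed_stirling_def degree_prod_eq_sum_degree)
    also have "of_int \<dots> / fact i = poly q x"
      by (simp add: q_def n poly_sum poly_monom sum_divide_distrib)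
    finally show ?thesis .
  qed
  then have "range of_nat \<subseteq> {x. poly (p - q) x = 0}" by auto
  moreover have "infinite (range (of_nat :: nat \<Rightarrow> 'a))"
    using range_inj_infinite[OF inj_of_nat] .
  ultimately have "infinite {x. poly (p - q) x = 0}"
    using finite_subset by blast
  then have "p = q"
    using poly_roots_finite[of "p - q"] by auto
  then have "coeff p j = coeff q j" by simp
  then show ?thesis using assms
    by (simp add: p_def q_def coeff_sum divide_eq_eq mult_ac)
qed

lemma bernoulli_plus_0: "bernoulli_plus 0 = 1"
  using arg_cong[OF bernoulli_plus_egf, of "\<lambda>f. fps_nth f 1"]
  by (simp add: fps_mult_nth)

text \<open>The coefficient at \<open>0\<close> vanishes because of the division by \<open>real 0\<close>.\<close>
definition bernoulli_log :: "complex fps" where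
  "bernoulli_log = Abs_fps (\<lambda>j. of_real (bernoulli_plus j / (real j * fact j)))"

lemma bernoulli_log_nth_0 [simp]: "fps_nth bernoulli_log 0 = 0"
  by (simp add: bernoulli_log_def)

text \<open>With \<open>V = (e^X - 1) / X\<close>, the Bernoulli series is
  \<open>X * (X * V)' / (X * V) = 1 + X * V' / V\<close>. By definition of
  \<open>bernoulli_log\<close> it is also \<open>1 + X * bernoulli_log'\<close>. So \<open>V\<close>
  has logarithmic derivative \<open>bernoulli_log'\<close> and constant term 1.\<close>

lemma fps_exp_bernoulli_log: "fps_X * (fps_exp 1 oo bernoulli_log) = fps_exp 1 - 1"
proof -
  define B :: "complex fps" where "B = Abs_fps (\<lambda>j. of_real (bernoulli_plus j / fact j))"
  define V :: "complex fps" where "V = fps_shift 1 (fps_exp 1 - 1)"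
  have XV: "fps_X * V = fps_exp 1 - 1"
    by (rule fps_ext) (simp add: V_def)
  \<comment> \<open>The real identity \<open>bernoulli_plus_egf\<close> is carried over to complex
    series coefficient by coefficient.\<close>
  have B: "B * (fps_exp 1 - 1) = fps_X * fps_exp 1"
  proof (rule fps_ext)
    fix n
    show "fps_nth (B * (fps_exp 1 - 1)) n = fps_nth (fps_X * fps_exp 1) n"
      using arg_cong[OF bernoulli_plus_egf, of "\<lambda>f. complex_of_real (fps_nth f n)"]
      by (simp add: B_def fps_mult_nth if_distrib[of complex_of_real] cong: if_cong)
  qed
  have B': "B = 1 + fps_X * fps_deriv bernoulli_log"
  proof (rule fps_ext)
    fix n show "fps_nth B n = fps_nth (1 + fps_X * fps_deriv bernoulli_log) n"
      by (cases n) (simp_all add: B_def bernoulli_log_def bernoulli_plus_0)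
  qed
  have "fps_deriv (fps_X * V) = fps_exp 1" unfolding XV by simp
  then have "V + fps_X * fps_deriv V = fps_exp 1" by (simp add: add.commute)
  then have "fps_X * (V + fps_X * fps_deriv V) = B * (fps_X * V)"
    unfolding XV B by simp
  then have "fps_X * fps_X * fps_deriv V = fps_X * fps_X * (fps_deriv bernoulli_log * V)"
    unfolding B' by (simp add: algebra_simps)
  then have "fps_deriv V = fps_deriv bernoulli_log * V" by simp
  moreover have "fps_nth V 0 = 1" by (simp add: V_def)
  ultimately show ?thesis using fps_exp_compose_eqI[of bernoulli_log V] XV by simp
qed

subsection \<open>Divisor sums and products\<close>

lemma jordan_totient_1 [simp]: "jordan_totient j (Suc 0) = 1"
  by (simp add: jordan_totient_def)

lemma jordan_totient_mult_coprime:
  assumes "coprime m n" "m > 0" "n > 0"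
  shows "jordan_totient j (m * n) = jordan_totient j m * jordan_totient j n"
proof -
  have "prime_factors m \<inter> prime_factors n = {}"
    using assms(1) by (meson coprime_common_divisor disjoint_iff in_prime_factors_iff not_prime_unit)
  then show ?thesis
    using assms(2,3)
    by (simp add: jordan_totient_def prime_factors_product prod.union_disjoint power_mult_distrib)
qed

lemma jordan_totient_prime_power_Suc:
  assumes "prime p"
  shows "jordan_totient j (p ^ Suc i) = real (p ^ Suc i) ^ j - real (p ^ i) ^ j"
proof -
  have "p > 0" using assms by (simp add: prime_gt_0_nat)
  then show ?thesis
    using assms
    by (simp add: jordan_totient_def prime_factors_power prime_prime_factors field_simps del: power_Suc)
       (simp add: power_mult_distrib)
qed

text \<open>The differences from the preceding lemma telescope; the term \<open>i = 0\<close>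
  contributes the initial 1.\<close>

lemma sum_jordan_totient_prime_power:
  assumes "prime p"
  shows "(\<Sum>i\<le>a. jordan_totient j (p ^ i)) = real (p ^ a) ^ j"
  by (induction a) (simp_all add: jordan_totient_prime_power_Suc[OF assms] del: power_Suc)

text \<open>Each divisor is uniquely \<open>p ^ i * d\<close> with \<open>d dvd m\<close>, where
  \<open>i\<close> is its multiplicity at \<open>p\<close>.\<close>

lemma sum_divisors_prime_power_mult:
  fixes f :: "nat \<Rightarrow> 'a::comm_monoid_add"
  assumes p: "prime p" and m: "\<not> p dvd m" "m > 0"
  shows "(\<Sum>d | d dvd p ^ a * m. f d) = (\<Sum>i\<le>a. \<Sum>d | d dvd m. f (p ^ i * d))"
proof -
  have *: "multiplicity p (p ^ i * d) = i" if "d dvd m" for i d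
    using that m p by (intro multiplicity_eqI) (auto dest: dvd_trans)
  have p0: "p > 0" using p by (simp add: prime_gt_0_nat)
  have "(\<Sum>i\<le>a. \<Sum>d | d dvd m. f (p ^ i * d)) = (\<Sum>(i, d)\<in>{..a} \<times> {d. d dvd m}. f (p ^ i * d))"
    by (rule sum.cartesian_product)
  also have "\<dots> = (\<Sum>d | d dvd p ^ a * m. f d)"
  proof (rule sum.reindex_bij_witness[where j = "\<lambda>(i, d). p ^ i * d"
          and i = "\<lambda>d. (multiplicity p d, d div p ^ multiplicity p d)"], goal_cases)
    case (1 x)
    then show ?case using p0 by (auto simp: *)
  next
    case (2 x)
    then show ?case by (auto intro: mult_dvd_mono le_imp_power_dvd)
  next
    case (3 d)
    then show ?case by (simp add: multiplicity_dvd)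
  next
    case (4 d)
    then have "d \<noteq> 0" using p0 m by (intro notI) simp
    then obtain e where e: "d = p ^ multiplicity p d * e" "\<not> p dvd e"
      using p multiplicity_decompose'[of d p] by (metis not_prime_unit)
    have "multiplicity p d \<le> multiplicity p (p ^ a * m)"
      using 4 p0 m by (intro dvd_imp_multiplicity_le) auto
    then have "multiplicity p d \<le> a" using *[of m a] by simp
    moreover have "e dvd m"
    proof -
      have "coprime e (p ^ a)"
        using prime_imp_coprime[OF p e(2)] by (simp add: coprime_commute)
      moreover have "e dvd p ^ a * m" using 4 e(1) by (metis dvd_mult_right mem_Collect_eq)
      ultimately show ?thesis by (simp add: coprime_dvd_mult_right_iff)
    qed
    moreover have "d div p ^ multiplicity p d = e"
      using p0 e(1) by (metis nonzero_mult_div_cancel_left power_not_zero less_numeral_extra(3))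
    ultimately show ?case by simp
  next
    case (5 x)
    then show ?case by auto
  qed
  finally show ?thesis ..
qed

text \<open>Strong induction: splitting off the full power of one prime factors the sum by
  multiplicativity, leaving a telescoping sum and the smaller cofactor \<open>m\<close>.\<close>

lemma sum_divisors_jordan_totient:
  assumes "n > 0"
  shows "(\<Sum>d | d dvd n. jordan_totient j d) = real n ^ j"
  using assms
proof (induction n rule: less_induct)
  case (less n)
  show ?case
  proof (cases "n = 1")
    case True
    then show ?thesis by simp
  next
    case False
    then obtain p where p: "prime p" "p dvd n" using prime_factor_nat by blast
    then obtain m where m: "n = p ^ multiplicity p n * m" "\<not> p dvd m"
      using multiplicity_decompose'[of n p] less.prems by (metis not_gr0 not_prime_unit)
    define a where "a = multiplicity p n"
    have n: "n = p ^ a * m" using m(1) by (simp add: a_def)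
    have "a > 0" using p less.prems by (simp add: a_def prime_multiplicity_gt_zero_iff)
    have "m > 0" using less.prems n by (cases m) auto
    have "m < n"
      using n \<open>m > 0\<close> one_less_power[OF prime_gt_1_nat[OF p(1)] \<open>a > 0\<close>] by simp
    have "jordan_totient j (p ^ i * d) = jordan_totient j (p ^ i) * jordan_totient j d"
      if "d dvd m" for i d
    proof (rule jordan_totient_mult_coprime)
      show "coprime (p ^ i) d"
        using p(1) m(2) that by (meson coprime_power_left_iff dvd_trans prime_imp_coprime)
    qed (use p(1) \<open>m > 0\<close> that in \<open>auto simp: prime_gt_0_nat intro: dvd_pos_nat\<close>)
    then have "(\<Sum>d | d dvd n. jordan_totient j d)
        = (\<Sum>i\<le>a. jordan_totient j (p ^ i)) * (\<Sum>d | d dvd m. jordan_totient j d)"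
      using p(1) m(2) \<open>m > 0\<close> by (simp add: n sum_divisors_prime_power_mult sum_product)
    then show ?thesis
      using less.IH[OF \<open>m < n\<close> \<open>m > 0\<close>] sum_jordan_totient_prime_power[OF p(1)]
      by (simp add: n power_mult_distrib)
  qed
qed

text \<open>Group the roots \<open>c k\<close>, for \<open>1 \<le> k \<le> n\<close>, by
  \<open>d = gcd k n\<close>: those in \<open>A d\<close> are the primitive roots of unity of order
  \<open>n div d\<close>.\<close>

lemma prod_cyclotomic_poly:
  assumes "n > 0"
  shows "(\<Prod>d | d dvd n. cyclotomic_poly d) = monom 1 n - 1"
proof -
  define c where "c k = cis (2 * pi * real k / real n)" for k
  define A where "A d = {k\<in>{0<..n}. gcd k n = d}" for d
  have "(\<Prod>d | d dvd n. cyclotomic_poly d) = (\<Prod>d | d dvd n. cyclotomic_poly (n div d))"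
    using assms by (intro prod.reindex_bij_witness[of _ "(div) n" "(div) n"]) (auto elim: dvdE)
  also have "\<dots> = (\<Prod>d | d dvd n. \<Prod>k\<in>A d. [:- c k, 1:])"
  proof (rule prod.cong)
    fix d assume "d \<in> {d. d dvd n}"
    then have d: "d dvd n" "d > 0" using assms by (auto intro: dvd_pos_nat)
    have "(\<Prod>k\<in>A d. [:- c k, 1:]) = (\<Prod>k\<in>totatives (n div d). [:- c (k * d), 1:])"
      unfolding A_def by (rule prod.reindex_bij_betw[OF bij_betw_totatives_gcd_eq, symmetric]) (use d assms in auto)
    also have "\<dots> = cyclotomic_poly (n div d)"
      unfolding cyclotomic_poly_def c_def using d
      by (intro prod.cong) (auto simp: real_of_nat_div field_simps)
    finally show "cyclotomic_poly (n div d) = (\<Prod>k\<in>A d. [:- c k, 1:])" ..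
  qed auto
  also have "\<dots> = (\<Prod>k\<in>(\<Union>d\<in>{d. d dvd n}. A d). [:- c k, 1:])"
    using assms by (intro prod.UNION_disjoint[symmetric]) (auto simp: A_def)
  \<comment> \<open>The classes exhaust \<open>1, ..., n\<close>. Since \<open>c n = c 0\<close>,
    index \<open>n\<close> can be traded for 0, giving the range \<open>{..<n}\<close> that
    parametrises the roots of unity.\<close>
  also have "(\<Union>d\<in>{d. d dvd n}. A d) = insert n ({..<n} - {0})"
    using assms by (auto simp: A_def)
  also have "(\<Prod>k\<in>\<dots>. [:- c k, 1:]) = (\<Prod>k\<in>insert 0 ({..<n} - {0}). [:- c k, 1:])"
  proof -
    have "c n = c 0" using assms by (simp add: c_def)
    then show ?thesis
      by (subst (1 2) prod.insert) auto
  qed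
  also have "insert 0 ({..<n} - {0}) = {..<n}" using assms by auto
  also have "(\<Prod>k<n. [:- c k, 1:]) = (\<Prod>z | z ^ n = 1. [:- z, 1:])"
    unfolding c_def by (rule prod.reindex_bij_betw[OF bij_betw_roots_unity[OF assms]])
  \<comment> \<open>Both polynomials are monic of degree \<open>n\<close> and vanish at the same
    \<open>n\<close> points.\<close>
  also have "\<dots> = monom 1 n - 1"
  proof (rule poly_eqI_degree_lead_coeff[where n = n and A = "{z. z ^ n = 1}"])
    have fin: "finite {z::complex. z ^ n = 1}"
      using assms by (intro finite_roots_unity) auto
    have card: "card {z::complex. z ^ n = 1} = n"
      using assms by (rule card_roots_unity_eq)
    let ?p = "\<Prod>z | z ^ n = 1. [:- z, 1::complex:]"
    have deg: "degree ?p = n"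
      using fin card by (subst degree_prod_eq_sum_degree) auto
    have "lead_coeff ?p = 1" by (simp add: lead_coeff_prod)
    then show "coeff ?p n = coeff (monom 1 n - 1) n"
      using deg assms by simp
    show "n \<le> card {z::complex. z ^ n = 1}" using card by simp
    show "degree ?p \<le> n" using deg by simp
    show "degree (monom 1 n - 1 :: complex poly) \<le> n"
      by (intro degree_diff_le) (auto simp: degree_monom_le)
    show "poly ?p z = poly (monom 1 n - 1) z" if "z \<in> {z. z ^ n = 1}" for z
      using that fin by (auto simp: poly_prod poly_monom)
  qed
  finally show ?thesis .
qed

subsection \<open>Cyclotomic polynomials around 1\<close>

lemma fps_const_prod: "fps_const (\<Prod>i\<in>A. f i :: 'a::comm_ring_1) = (\<Prod>i\<in>A. fps_const (f i))"
  by (induction A rule: infinite_finite_induct) (simp_all flip: fps_const_mult)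

lemma pcompose_power: "pcompose (p ^ n) (q :: 'a::comm_semiring_1 poly) = pcompose p q ^ n"
  by (induction n) (simp_all add: pcompose_1 pcompose_mult)

text \<open>For \<open>n \<ge> 2\<close> this will be the logarithm of
  \<open>\<Phi>_n (1 + X) / exp (mangoldt n)\<close>; for \<open>n = 1\<close> it is that of
  \<open>X / ln (1 + X)\<close>. Division by \<open>real 0\<close> makes the coefficient at
  \<open>j = 0\<close> vanish.\<close>

definition cyclotomic_log :: "nat \<Rightarrow> complex fps" where
  "cyclotomic_log n =
     Abs_fps (\<lambda>j. of_real (bernoulli_plus j * jordan_totient j n / (real j * fact j))) oo fps_ln 1"

lemma cyclotomic_log_nth_0 [simp]: "fps_nth (cyclotomic_log n) 0 = 0"
  by (simp add: cyclotomic_log_def)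

text \<open>Expanding the powers of \<open>fps_ln 1\<close> in Stirling numbers produces the
  arguments of the Bell polynomial, each over \<open>fact i\<close>.\<close>

lemma cyclotomic_log_nth:
  "fps_nth (cyclotomic_log n) i =
     of_real ((\<Sum>j=1..i. bernoulli_plus j * real_of_int (signed_stirling i j) / real j * jordan_totient j n) / fact i)"
proof -
  have "fps_nth (cyclotomic_log n) i = (\<Sum>j=0..i. of_real (bernoulli_plus j *
        real_of_int (signed_stirling i j) / real j * jordan_totient j n / fact i))"
    unfolding cyclotomic_log_def fps_compose_nth
    by (intro sum.cong) (auto simp: fps_ln_power_nth)
  also have "\<dots> = (\<Sum>j=1..i. of_real (bernoulli_plus j *
        real_of_int (signed_stirling i j) / real j * jordan_totient j n / fact i))"
    by (rule sum.mono_neutral_right) auto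
  finally show ?thesis by (simp add: sum_divide_distrib)
qed

text \<open>Summing the Jordan totients over the divisors puts \<open>n^j\<close> into the
  \<open>j\<close>-th coefficient, which amounts to substituting \<open>n * X\<close> into
  \<open>bernoulli_log\<close>.\<close>

lemma sum_cyclotomic_log:
  assumes "n > 0"
  shows "(\<Sum>d | d dvd n. cyclotomic_log d) = bernoulli_log oo (fps_const (of_nat n) * fps_X) oo fps_ln 1"
proof -
  have "(\<Sum>d | d dvd n. Abs_fps (\<lambda>j. complex_of_real (bernoulli_plus j * jordan_totient j d / (real j * fact j))))
      = bernoulli_log oo (fps_const (of_nat n) * fps_X)"
  proof (rule fps_ext)
    fix j
    have "complex_of_real (\<Sum>d | d dvd n. bernoulli_plus j * jordan_totient j d / (real j * fact j))
        = complex_of_real (bernoulli_plus j * (\<Sum>d | d dvd n. jordan_totient j d) / (real j * fact j))"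
      by (simp add: sum_divide_distrib sum_distrib_left)
    then show "fps_nth (\<Sum>d | d dvd n. Abs_fps (\<lambda>j. complex_of_real (bernoulli_plus j * jordan_totient j d / (real j * fact j)))) j
      = fps_nth (bernoulli_log oo (fps_const (of_nat n) * fps_X)) j"
      by (simp add: fps_sum_nth fps_compose_linear bernoulli_log_def sum_divisors_jordan_totient[OF assms])
  qed
  then show ?thesis unfolding cyclotomic_log_def fps_compose_sum_distrib[symmetric] by simp
qed

text \<open>Substitute first \<open>n * X\<close> and then \<open>ln (1 + X)\<close> into
  \<open>fps_exp_bernoulli_log\<close>; \<open>exp (n * X)\<close> turns into the binomial series
  \<open>(1 + X) ^ n\<close>.\<close>

lemma fps_ln_times_exp_sum_cyclotomic_log:
  assumes "n > 0"
  shows "fps_const (of_nat n) * fps_ln 1 * (fps_exp 1 oo (\<Sum>d | d dvd n. cyclotomic_log d)) = (1 + fps_X) ^ n - 1"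
proof -
  define N :: "complex fps" where "N = fps_const (of_nat n) * fps_X"
  have N: "fps_nth N 0 = 0" by (simp add: N_def)
  have "(fps_X * (fps_exp 1 oo bernoulli_log)) oo N = (fps_exp 1 - 1) oo N"
    by (simp only: fps_exp_bernoulli_log)
  then have "N * (fps_exp 1 oo (bernoulli_log oo N)) = fps_exp (of_nat n) - 1"
    by (simp add: fps_compose_mult_distrib[OF N] fps_compose_sub_distrib N fps_compose_assoc) (simp add: N_def)
  then have "(N * (fps_exp 1 oo (bernoulli_log oo N))) oo fps_ln 1 = (fps_exp (of_nat n) - 1) oo fps_ln 1"
    by simp
  then have "fps_const (of_nat n) * fps_ln 1 * (fps_exp 1 oo (bernoulli_log oo N oo fps_ln 1)) = (1 + fps_X) ^ n - 1"
    by (simp add: fps_compose_mult_distrib fps_compose_sub_distrib fps_exp_compose_ln fps_binomial_of_nat)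
       (simp add: N_def N fps_compose_assoc fps_compose_mult_distrib)
  then show ?thesis by (simp add: sum_cyclotomic_log[OF assms] N_def)
qed

text \<open>The divisor 1 is set apart: its exponential absorbs the factor \<open>fps_ln 1\<close>
  and leaves \<open>fps_X\<close>, while the factor \<open>n\<close> is distributed over the other
  divisors as \<open>exp (mangoldt d)\<close>.\<close>

lemma fps_X_times_prod_exp_cyclotomic_log:
  assumes "n > 0"
  shows "fps_X * (\<Prod>d\<in>{d. d dvd n} - {1}. fps_const (of_real (exp (mangoldt d))) * (fps_exp 1 oo cyclotomic_log d))
     = (1 + fps_X) ^ n - 1"
proof -
  define D where "D = {d. d dvd n} - {1}"
  have fin: "finite {d. d dvd n}" using assms by simp
  have ins: "{d. d dvd n} = insert 1 D" "1 \<notin> D" "finite D" using assms by (auto simp: D_def)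
  \<comment> \<open>The divisor 1 may be added to the sum because
    \<open>mangoldt 1 = 0\<close>.\<close>
  have "(\<Prod>d\<in>D. exp (mangoldt d)) = exp (\<Sum>d | d dvd n. mangoldt d :: real)"
    unfolding ins using ins by (simp add: exp_sum)
  also have "\<dots> = real n" using assms by (simp add: mangoldt_sum)
  finally have n: "(\<Prod>d\<in>D. complex_of_real (exp (mangoldt d))) = of_nat n"
    by (metis of_real_of_nat_eq of_real_prod)
  have X: "fps_ln 1 * (fps_exp 1 oo cyclotomic_log 1) = fps_X"
    using fps_ln_times_exp_sum_cyclotomic_log[of 1] by simp
  have "fps_const (of_nat n) * (\<Prod>d | d dvd n. fps_exp 1 oo cyclotomic_log d) * fps_ln 1 = (1 + fps_X) ^ n - 1"
    using fps_ln_times_exp_sum_cyclotomic_log[OF assms] fin by (simp add: fps_exp_compose_sum mult_ac)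
  also have "(\<Prod>d | d dvd n. fps_exp 1 oo cyclotomic_log d)
      = (fps_exp 1 oo cyclotomic_log 1) * (\<Prod>d\<in>D. fps_exp 1 oo cyclotomic_log d)"
    unfolding ins using ins by simp
  also have "fps_const (of_nat n) * \<dots> * fps_ln 1 =
      (fps_ln 1 * (fps_exp 1 oo cyclotomic_log 1)) * (fps_const (of_nat n) * (\<Prod>d\<in>D. fps_exp 1 oo cyclotomic_log d))"
    by (simp only: mult_ac)
  also have "\<dots> = fps_X * (\<Prod>d\<in>D. fps_const (of_real (exp (mangoldt d))) * (fps_exp 1 oo cyclotomic_log d))"
    unfolding X n[symmetric] by (simp add: prod.distrib fps_const_prod)
  finally show ?thesis by (simp only: D_def)
qed

text \<open>Both families, \<open>P\<close> and \<open>W\<close>, satisfy the same product formula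
  over the divisors other than 1. By induction the factors at proper divisors agree, and cancelling
  them leaves the factors at \<open>n\<close>.\<close>

lemma fps_of_poly_cyclotomic_poly_shift:
  assumes "n \<ge> 2"
  shows "fps_of_poly (pcompose (cyclotomic_poly n) [:1, 1:]) =
    fps_const (of_real (exp (mangoldt n))) * (fps_exp 1 oo cyclotomic_log n)"
  using assms
proof (induction n rule: less_induct)
  case (less n)
  define P where "P d = fps_of_poly (pcompose (cyclotomic_poly d) [:1, 1:])" for d
  define W :: "nat \<Rightarrow> complex fps"
    where "W d = fps_const (of_real (exp (mangoldt d))) * (fps_exp 1 oo cyclotomic_log d)" for d
  define D where "D = {d. d dvd n} - {1, n}"
  have ins: "{d. d dvd n} - {1} = insert n D" "n \<notin> D" "finite D" "{d. d dvd n} = insert 1 (insert n D)" "1 \<notin> insert n D"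
    using less.prems by (auto simp: D_def)
  have "P d = W d" if "d \<in> D" for d
  proof -
    have "d dvd n" "d \<noteq> 1" "d \<noteq> n" using that by (auto simp: D_def)
    then have "d < n" "d \<ge> 2"
      using less.prems dvd_imp_le[of d n] by (cases d; cases "d - 1"; force)+
    then show ?thesis using less.IH by (simp add: P_def W_def)
  qed
  then have PW: "prod P D = prod W D" by (rule prod.cong[OF refl])
  \<comment> \<open>\<open>\<Phi>_1 (1 + X) = X\<close> supplies the factor \<open>fps_X\<close>
    that stands for the divisor 1 in the formula for \<open>W\<close>.\<close>
  have "P 1 = fps_X"
    by (simp add: P_def cyclotomic_poly_def pcompose_pCons cis_2pi)
  moreover have "(\<Prod>d | d dvd n. P d) = (1 + fps_X) ^ n - 1"
  proof -
    have "(\<Prod>d | d dvd n. P d) = fps_of_poly (pcompose (monom 1 n - 1) [:1, 1:])"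
      using less.prems by (simp add: P_def prod_cyclotomic_poly flip: fps_of_poly_prod pcompose_prod)
    also have "monom 1 n = ([:0, 1:] :: complex poly) ^ n"
      by (simp add: monom_altdef)
    also have "pcompose (\<dots> - 1) [:1, 1:] = [:1, 1:] ^ n - 1"
      by (simp add: pcompose_diff pcompose_power pcompose_1 pcompose_pCons)
    finally show ?thesis
      by (simp add: fps_of_poly_diff fps_of_poly_power)
  qed
  ultimately have "fps_X * (P n * prod W D) = (1 + fps_X) ^ n - 1"
    using ins(5) by (simp add: ins PW)
  also have "\<dots> = fps_X * (W n * prod W D)"
    using fps_X_times_prod_exp_cyclotomic_log[of n] less.prems ins by (simp add: W_def)
  finally have "fps_X * prod W D * P n = fps_X * prod W D * W n" by (simp only: mult_ac)
  \<comment> \<open>Cancellation is legitimate because the constant term of \<open>W d\<close> is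
    \<open>exp (mangoldt d)\<close>.\<close>
  moreover have "W d \<noteq> 0" for d
  proof -
    have "fps_nth (W d) 0 \<noteq> 0" by (simp add: W_def)
    then show ?thesis by auto
  qed
  then have "fps_X * prod W D \<noteq> 0" using ins by simp
  ultimately show ?case unfolding P_def[symmetric] W_def[symmetric] by simp
qed

text \<open>With \<open>q x = p (x + 1)\<close> one has \<open>p x = q (x - 1)\<close>; expand each
  \<open>(x - 1) ^ t\<close> by the binomial theorem.\<close>

lemma coeff_eq_sum_pcompose_shift:
  fixes p :: "'a::{comm_ring_1,semiring_no_zero_divisors} poly"
  shows "coeff p k = (\<Sum>t=k..degree p. coeff (pcompose p [:1, 1:]) t * of_nat (t choose k) * (- 1) ^ (t - k))"
proof -
  define q where "q = pcompose p [:1, 1:]"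
  have deg: "degree q = degree p" by (simp add: q_def degree_pcompose)
  have "p = pcompose q [:-1, 1:]"
    by (simp add: q_def pcompose_pCons flip: pcompose_assoc)
  also have "\<dots> = pcompose (\<Sum>t\<le>degree p. smult (coeff q t) ([:0, 1:] ^ t)) [:-1, 1:]"
    using poly_as_sum_of_monoms[of q] by (simp add: deg monom_altdef)
  also have "\<dots> = (\<Sum>t\<le>degree p. smult (coeff q t) ([:-1, 1:] ^ t))"
    by (simp add: pcompose_sum pcompose_smult pcompose_power pcompose_pCons)
  finally have "coeff p k = (\<Sum>t\<le>degree p. coeff q t * coeff ([:-1, 1:] ^ t) k)"
    by (metis (no_types, lifting) coeff_smult coeff_sum sum.cong)
  also have "\<dots> = (\<Sum>t=k..degree p. coeff q t * of_nat (t choose k) * (- 1) ^ (t - k))"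
  proof (rule sum.mono_neutral_cong_right)
    have "coeff ([:-1, 1:] ^ t :: 'a poly) k = 0" if "t < k" for t
      using that by (intro coeff_eq_0 le_less_trans[OF degree_power_le]) simp
    then show "\<forall>t\<in>{..degree p} - {k..degree p}. coeff q t * coeff ([:-1, 1:] ^ t) k = 0"
      by auto
  qed (auto simp: coeff_linear_poly_power mult.assoc)
  finally show ?thesis by (simp only: q_def)
qed

theorem theorem4p3:
  fixes n k :: nat
  assumes "n \<ge> 2" and "k \<ge> 1" and "k \<le> totient n"
  shows "Polynomial.coeff (cyclotomic_poly n) k =
    complex_of_real (exp (mangoldt n) / fact k *
      (\<Sum>t=k..totient n. (- 1) ^ (t - k) / fact (t - k) *
         complete_bell t (\<lambda>i. \<Sum>j=1..i.
           bernoulli_plus j * real_of_int (signed_stirling i j) / real j * jordan_totient j n)))"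
proof -
  define x where "x i = (\<Sum>j=1..i.
      bernoulli_plus j * real_of_int (signed_stirling i j) / real j * jordan_totient j n)" for i
  have shift: "coeff (pcompose (cyclotomic_poly n) [:1, 1:]) t =
      complex_of_real (exp (mangoldt n) * (complete_bell t x / fact t))" for t
  proof -
    have "coeff (pcompose (cyclotomic_poly n) [:1, 1:]) t =
        fps_nth (fps_of_poly (pcompose (cyclotomic_poly n) [:1, 1:])) t"
      by simp
    also have "\<dots> = of_real (exp (mangoldt n)) * fps_nth (fps_exp 1 oo cyclotomic_log n) t"
      unfolding fps_of_poly_cyclotomic_poly_shift[OF assms(1)] by simp
    also have "fps_nth (fps_exp 1 oo cyclotomic_log n) t = of_real (complete_bell t x / fact t)"
      by (rule complete_bell_egf[OF cyclotomic_log_nth_0]) (simp only: cyclotomic_log_nth x_def)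
    finally show ?thesis by simp
  qed
  have "coeff (cyclotomic_poly n) k = (\<Sum>t=k..totient n.
      complex_of_real (exp (mangoldt n) * (complete_bell t x / fact t)) * of_nat (t choose k) * (- 1) ^ (t - k))"
    using coeff_eq_sum_pcompose_shift[of "cyclotomic_poly n" k]
    by (simp only: degree_cyclotomic_poly shift)
  \<comment> \<open>Writing \<open>t choose k\<close> by factorials cancels the
    \<open>fact t\<close> of the generating function and leaves \<open>fact k * fact (t - k)\<close>
    in the denominator.\<close>
  also have "\<dots> = (\<Sum>t=k..totient n.
      complex_of_real (exp (mangoldt n) / fact k * ((- 1) ^ (t - k) / fact (t - k) * complete_bell t x)))"
    by (intro sum.cong) (simp_all add: binomial_fact)
  also have "\<dots> = complex_of_real (exp (mangoldt n) / fact k *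
      (\<Sum>t=k..totient n. (- 1) ^ (t - k) / fact (t - k) * complete_bell t x))"
    by (simp only: sum_distrib_left of_real_sum)
  finally show ?thesis unfolding x_def .
qed

end
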